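(* Up to isomorphism there are exactly ten 2-qBMGs on the vertex set $\{v_1,v_2,v_3,v_4\}$ whose underlying undirected graph is a cycle $C_4$, namely those with edge sets $\{v_1v_2,v_1v_4,v_2v_1,v_2v_3,v_3v_4,v_4v_3\}$, $\{v_1v_2,v_1v_4,v_2v_3,v_3v_2,v_3v_4,v_4v_3\}$, $\{v_1v_2,v_1v_4,v_3v_2,v_3v_4\}$, $\{v_1v_2,v_1v_4,v_3v_2,v_4v_3\}$, $\{v_1v_2,v_2v_1,v_3v_2,v_3v_4,v_4v_1\}$, $\{v_1v_2,v_1v_4,v_3v_2,v_4v_1,v_4v_3\}$, $\{v_1v_2,v_1v_4,v_2v_3,v_4v_3\}$, $\{v_1v_2,v_1v_4,v_3v_2,v_3v_4,v_4v_3\}$, $\{v_1v_2,v_1v_4,v_2v_1,v_2v_3,v_3v_2,v_3v_4\}$, $\{v_1v_2,v_1v_4,v_3v_2,v_3v_4,v_2v_1,v_2v_3,v_4v_1,v_4v_3\}$ (where $xy$ denotes the directed edge from $x$ to $y$).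
   Context: A two-color quasi best match graph (2-qBMG) is a bipartite directed graph $\overrightarrow{G}$ (vertex set split into two color classes, every edge joining vertices of different colors) without loops and parallel edges, satisfying: (N1) if $u$ and $v$ are two independent (non-adjacent) vertices then there exist no vertices $w,t$ such that $ut, vw, tw$ are edges; (N2) if $uv, vw, wt$ are edges then $ut$ is an edge; (N3) if $u$ and $v$ have a common out-neighbor then either every out-neighbor of $u$ is an out-neighbor of $v$ or every out-neighbor of $v$ is an out-neighbor of $u$. The underlying undirected graph of a digraph has the same vertex set and an undirected edge $\{u,v\}$ whenever $uv$ or $vu$ is a directed edge. Two digraphs on the same vertex set $V$ are isomorphic if some permutation $\varphi$ of $V$ satisfies: $xy$ is an edge of the first iff $\varphi(x)\varphi(y)$ is an edge of the second. *)

theory Defs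
  imports "Graph_Theory.Pair_Digraph" "HOL-Combinatorics.Permutations"
begin

text \<open>Only the existence of a 2-colouring is required; the colouring is not part of the structure,
  so isomorphisms need not respect it.\<close>

definition bipartite_digraph :: "'a pair_pre_digraph \<Rightarrow> bool" where
  "bipartite_digraph G \<longleftrightarrow>
     (\<exists>A B. A \<union> B = pverts G \<and> A \<inter> B = {} \<and> parcs G \<subseteq> A \<times> B \<union> B \<times> A)"

text \<open>Parallel edges are excluded by the representation: \<open>parcs G\<close> is a set of pairs.\<close>

locale two_qBMG = pair_loopfree_digraph G for G :: "'a pair_pre_digraph" +
  assumes bipartite: "bipartite_digraph G"
    and N1: "\<lbrakk>u \<in> pverts G; v \<in> pverts G; u \<noteq> v; (u, v) \<notin> parcs G; (v, u) \<notin> parcs G\<rbrakk>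
      \<Longrightarrow> \<not> (\<exists>w t. (u, t) \<in> parcs G \<and> (v, w) \<in> parcs G \<and> (t, w) \<in> parcs G)"
    and N2: "\<lbrakk>(u, v) \<in> parcs G; (v, w) \<in> parcs G; (w, t) \<in> parcs G\<rbrakk> \<Longrightarrow> (u, t) \<in> parcs G"
    and N3: "\<lbrakk>(u, x) \<in> parcs G; (v, x) \<in> parcs G\<rbrakk>
      \<Longrightarrow> parcs G `` {u} \<subseteq> parcs G `` {v} \<or> parcs G `` {v} \<subseteq> parcs G `` {u}"

definition underlying_edges :: "'a pair_pre_digraph \<Rightarrow> 'a set set" where
  "underlying_edges G = {{u, v} | u v. (u, v) \<in> parcs G \<or> (v, u) \<in> parcs G}"

definition is_cycle_graph :: "nat \<Rightarrow> 'a set \<Rightarrow> 'a set set \<Rightarrow> bool" where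
  "is_cycle_graph n V E \<longleftrightarrow> 3 \<le> n \<and>
     (\<exists>xs. length xs = n \<and> distinct xs \<and> set xs = V \<and>
           E = {{xs ! i, xs ! (Suc i mod n)} | i. i < n})"

definition isomorphic_digraphs :: "'a pair_pre_digraph \<Rightarrow> 'a pair_pre_digraph \<Rightarrow> bool" where
  "isomorphic_digraphs G H \<longleftrightarrow> pverts G = pverts H \<and>
     (\<exists>\<phi>. \<phi> permutes pverts G \<and>
          (\<forall>x\<in>pverts G. \<forall>y\<in>pverts G. (x, y) \<in> parcs G \<longleftrightarrow> (\<phi> x, \<phi> y) \<in> parcs H))"

definition C4_qBMGs :: "'a set \<Rightarrow> 'a pair_pre_digraph set" where
  "C4_qBMGs V = {G. two_qBMG G \<and> pverts G = V \<and> is_cycle_graph 4 V (underlying_edges G)}"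

end

theory Submission
  imports Defs
begin

text \<open>The 4-cycle is the complete bipartite graph on two pairs, and for its orientations (N1) and
  (N3) hold automatically. What remains of the axioms is (N2): a directed path of length 3 forces the
  arc from its start to its end. A finite check of the presence of the eight possible arcs shows that,
  up to the eight symmetries of the cycle, ten orientations satisfy this. They are pairwise
  non-isomorphic because the number of vertices with an out-neighbour, the number of vertices with an
  in-neighbour and the number of pairs joined by a directed path of length 2 distinguish them.\<close>

section \<open>Isomorphism classes and how to count them\<close>

text \<open>Sending each element of \<open>T\<close> to its class is a bijection onto the quotient:
  \<open>inj\<close> makes it injective and \<open>cover\<close> makes it surjective.\<close>

lemma card_quotient_transversal:
  assumes r: "equiv S r" and "T \<subseteq> S"
    and inj: "\<And>x y. \<lbrakk>x \<in> T; y \<in> T; (x, y) \<in> r\<rbrakk> \<Longrightarrow> x = y"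
    and cover: "\<And>x. x \<in> S \<Longrightarrow> \<exists>y\<in>T. (x, y) \<in> r"
  shows "card (S // r) = card T"
proof -
  have "inj_on (\<lambda>x. r `` {x}) T"
    using assms eq_equiv_class_iff[OF r] by (intro inj_onI) blast
  moreover have "(\<lambda>x. r `` {x}) ` T = S // r"
  proof
    show "(\<lambda>x. r `` {x}) ` T \<subseteq> S // r"
      using \<open>T \<subseteq> S\<close> by (auto intro: quotientI)
    show "S // r \<subseteq> (\<lambda>x. r `` {x}) ` T"
    proof
      fix C assume "C \<in> S // r"
      then obtain x where "x \<in> S" "C = r `` {x}" by (auto elim: quotientE)
      moreover then obtain y where "y \<in> T" "(x, y) \<in> r" using cover by blast
      ultimately show "C \<in> (\<lambda>x. r `` {x}) ` T"
        using equiv_class_eq[OF r] by blast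
    qed
  qed
  ultimately show ?thesis by (metis card_image)
qed

lemma isomorphic_digraphs_refl: "isomorphic_digraphs G G"
  unfolding isomorphic_digraphs_def by (auto intro!: exI[of _ id] permutes_id)

lemma isomorphic_digraphs_sym:
  assumes "isomorphic_digraphs G H"
  shows "isomorphic_digraphs H G"
proof -
  from assms obtain \<phi> where V: "pverts G = pverts H" and \<phi>: "\<phi> permutes pverts G"
    and iso: "\<And>x y. \<lbrakk>x \<in> pverts G; y \<in> pverts G\<rbrakk> \<Longrightarrow> (x, y) \<in> parcs G \<longleftrightarrow> (\<phi> x, \<phi> y) \<in> parcs H"
    unfolding isomorphic_digraphs_def by blast
  have inv: "inv \<phi> permutes pverts G" using \<phi> by (rule permutes_inv)
  have "(x, y) \<in> parcs H \<longleftrightarrow> (inv \<phi> x, inv \<phi> y) \<in> parcs G"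
    if "x \<in> pverts G" "y \<in> pverts G" for x y
    using iso[of "inv \<phi> x" "inv \<phi> y"] that permutes_in_image[OF inv] permutes_inverses(1)[OF \<phi>]
    by simp
  then show ?thesis
    using V inv unfolding isomorphic_digraphs_def by (intro conjI exI[of _ "inv \<phi>"]) auto
qed

lemma isomorphic_digraphs_trans:
  assumes "isomorphic_digraphs G H" and "isomorphic_digraphs H K"
  shows "isomorphic_digraphs G K"
proof -
  from assms obtain \<phi> \<psi> where "\<phi> permutes pverts G" "\<psi> permutes pverts G"
    and "pverts G = pverts H" "pverts H = pverts K"
    and "\<And>x y. \<lbrakk>x \<in> pverts G; y \<in> pverts G\<rbrakk> \<Longrightarrow> (x, y) \<in> parcs G \<longleftrightarrow> (\<phi> x, \<phi> y) \<in> parcs H"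
    and "\<And>x y. \<lbrakk>x \<in> pverts G; y \<in> pverts G\<rbrakk> \<Longrightarrow> (x, y) \<in> parcs H \<longleftrightarrow> (\<psi> x, \<psi> y) \<in> parcs K"
    unfolding isomorphic_digraphs_def by metis
  then show ?thesis
    unfolding isomorphic_digraphs_def
    by (intro conjI exI[of _ "\<psi> \<circ> \<phi>"]) (auto simp: permutes_compose permutes_in_image)
qed

lemma equiv_isomorphic_digraphs:
  "equiv S {(G, H). G \<in> S \<and> H \<in> S \<and> isomorphic_digraphs G H}"
  by (intro equivI refl_onI symI transI)
    (auto intro: isomorphic_digraphs_refl isomorphic_digraphs_sym isomorphic_digraphs_trans)

section \<open>A numerical isomorphism invariant\<close>

text \<open>Two opposite arcs put loops \<open>(x, x)\<close> into \<open>A O A\<close>, so the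
  third number also reflects bidirected edges.\<close>

definition arc_invariants :: "('a \<times> 'a) set \<Rightarrow> nat \<times> nat \<times> nat" where
  "arc_invariants A = (card (Domain A), card (Range A), card (A O A))"

lemma arc_invariants_map_prod:
  assumes "inj f"
  shows "arc_invariants (map_prod f f ` A) = arc_invariants A"
proof -
  have "Domain (map_prod f f ` A) = f ` Domain A" "Range (map_prod f f ` A) = f ` Range A"
    by force+
  moreover have "map_prod f f ` A O map_prod f f ` A = map_prod f f ` (A O A)"
    using assms by (force dest: injD)
  moreover have "inj_on (map_prod f f) B" "inj_on f C" for B C
    using assms by (auto simp: inj_on_def)
  ultimately show ?thesis
    unfolding arc_invariants_def by (simp add: card_image)
qed

text \<open>An isomorphism carries one arc set onto the other by relabelling. Since
  \<open>isomorphic_digraphs\<close> compares arcs only between vertices, both arc sets are required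
  to stay inside the vertex sets.\<close>

lemma isomorphic_digraphs_arc_invariants:
  assumes "isomorphic_digraphs G H"
    and "parcs G \<subseteq> pverts G \<times> pverts G" and "parcs H \<subseteq> pverts H \<times> pverts H"
  shows "arc_invariants (parcs G) = arc_invariants (parcs H)"
proof -
  from assms(1) obtain \<phi> where V: "pverts G = pverts H" and \<phi>: "\<phi> permutes pverts G"
    and iso: "\<And>x y. \<lbrakk>x \<in> pverts G; y \<in> pverts G\<rbrakk> \<Longrightarrow> (x, y) \<in> parcs G \<longleftrightarrow> (\<phi> x, \<phi> y) \<in> parcs H"
    unfolding isomorphic_digraphs_def by blast
  have "parcs H = map_prod \<phi> \<phi> ` parcs G"
  proof
    show "map_prod \<phi> \<phi> ` parcs G \<subseteq> parcs H"
      using assms(2) iso by auto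
    show "parcs H \<subseteq> map_prod \<phi> \<phi> ` parcs G"
    proof
      fix e assume e: "e \<in> parcs H"
      then have "e \<in> \<phi> ` pverts G \<times> \<phi> ` pverts G"
        using assms(3) unfolding V[symmetric] permutes_image[OF \<phi>] by blast
      then obtain x y where "e = map_prod \<phi> \<phi> (x, y)" "x \<in> pverts G" "y \<in> pverts G"
        by auto
      with e iso show "e \<in> map_prod \<phi> \<phi> ` parcs G"
        by (metis image_eqI map_prod_simp)
    qed
  qed
  then show ?thesis
    using arc_invariants_map_prod[OF permutes_inj[OF \<phi>]] by metis
qed

section \<open>The 4-cycle as a complete bipartite graph\<close>

lemma is_cycle_graph_4_iff:
  "is_cycle_graph 4 V E \<longleftrightarrow>
     (\<exists>a b c d. distinct [a, b, c, d] \<and> V = {a, b, c, d} \<and> E = {{a, b}, {b, c}, {c, d}, {d, a}})"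
proof -
  have edges: "{{[a, b, c, d] ! i, [a, b, c, d] ! (Suc i mod 4)} | i. i < 4}
      = {{a, b}, {b, c}, {c, d}, {d, a}}" for a b c d :: 'a
  proof -
    \<comment> \<open>Written as an image of \<open>{..<4}\<close>, the edge set can be enumerated
      by simplification.\<close>
    have "{{[a, b, c, d] ! i, [a, b, c, d] ! (Suc i mod 4)} | i. i < 4}
        = (\<lambda>i. {[a, b, c, d] ! i, [a, b, c, d] ! (Suc i mod 4)}) ` {..<4}" by auto
    then show ?thesis
      by (simp add: lessThan_nat_numeral lessThan_Suc insert_commute)
  qed
  have "(\<exists>xs. length xs = 4 \<and> P xs) \<longleftrightarrow> (\<exists>a b c d. P [a, b, c, d])" for P :: "'a list \<Rightarrow> bool"
    by (force simp: numeral_eq_Suc length_Suc_conv)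
  then show ?thesis
    unfolding is_cycle_graph_def by (simp add: edges eq_commute[of _ V] cong: conj_cong)
qed

text \<open>These are the orientations of the complete bipartite graph on \<open>X\<close> and
  \<open>Y\<close> in which an edge may also be bidirected.\<close>

definition semicomplete_bipartite :: "'a set \<Rightarrow> 'a set \<Rightarrow> ('a \<times> 'a) set \<Rightarrow> bool" where
  "semicomplete_bipartite X Y A \<longleftrightarrow>
     A \<subseteq> X \<times> Y \<union> Y \<times> X \<and> (\<forall>x\<in>X. \<forall>y\<in>Y. (x, y) \<in> A \<or> (y, x) \<in> A)"

lemma underlying_edges_complete_bipartite_iff:
  "underlying_edges G = {{x, y} | x y. x \<in> X \<and> y \<in> Y} \<longleftrightarrow> semicomplete_bipartite X Y (parcs G)"
proof
  assume eq: "underlying_edges G = {{x, y} | x y. x \<in> X \<and> y \<in> Y}"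
  have "(u, v) \<in> X \<times> Y \<union> Y \<times> X" if "(u, v) \<in> parcs G" for u v
  proof -
    have "{u, v} \<in> underlying_edges G" using that unfolding underlying_edges_def by blast
    then show ?thesis unfolding eq by (auto simp: doubleton_eq_iff)
  qed
  moreover have "(x, y) \<in> parcs G \<or> (y, x) \<in> parcs G" if "x \<in> X" "y \<in> Y" for x y
  proof -
    have "{x, y} \<in> underlying_edges G" using that unfolding eq by blast
    then show ?thesis unfolding underlying_edges_def by (auto simp: doubleton_eq_iff)
  qed
  ultimately show "semicomplete_bipartite X Y (parcs G)"
    unfolding semicomplete_bipartite_def by (auto intro!: subrelI)
next
  assume G: "semicomplete_bipartite X Y (parcs G)"
  show "underlying_edges G = {{x, y} | x y. x \<in> X \<and> y \<in> Y}" (is "_ = ?E")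
  proof
    have "{u, v} \<in> ?E" if "(u, v) \<in> X \<times> Y \<union> Y \<times> X" for u v
      using that insert_commute[of u v "{}"] by auto
    moreover have "(u, v) \<in> X \<times> Y \<union> Y \<times> X" if "(u, v) \<in> parcs G \<or> (v, u) \<in> parcs G" for u v
      using that G unfolding semicomplete_bipartite_def by auto
    ultimately show "underlying_edges G \<subseteq> ?E"
      unfolding underlying_edges_def by (simp only: subset_iff mem_Collect_eq) metis
    show "?E \<subseteq> underlying_edges G"
      using G unfolding semicomplete_bipartite_def underlying_edges_def by blast
  qed
qed

text \<open>The two diagonals of the cycle are the sides of the complete bipartite graph.\<close>

lemma underlying_edges_4_cycle_iff:
  "underlying_edges G = {{a, b}, {b, c}, {c, d}, {d, a}} \<longleftrightarrow>
     semicomplete_bipartite {a, c} {b, d} (parcs G)"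
proof -
  have "{{a, b}, {b, c}, {c, d}, {d, a}} = (\<Union>x\<in>{a, c}. (\<lambda>y. {x, y}) ` {b, d})"
    by (simp add: insert_commute)
  also have "(\<Union>x\<in>X. (\<lambda>y. {x, y}) ` Y) = {{x, y} | x y. x \<in> X \<and> y \<in> Y}" for X Y :: "'a set"
    by auto
  finally have "{{a, b}, {b, c}, {c, d}, {d, a}} = {{x, y} | x y. x \<in> {a, c} \<and> y \<in> {b, d}}" .
  then show ?thesis
    by (simp only: underlying_edges_complete_bipartite_iff)
qed

text \<open>The inclusion on the right is (N2) in relational form. Completeness between the sides
  yields (N1), and the bound 2 on their sizes yields (N3).\<close>

lemma two_qBMG_semicomplete_bipartite_iff:
  assumes "X \<inter> Y = {}" and V: "pverts G = X \<union> Y"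
    and fin: "finite X" "finite Y" and card: "card X \<le> 2" "card Y \<le> 2"
    and A: "semicomplete_bipartite X Y (parcs G)"
  shows "two_qBMG G \<longleftrightarrow> parcs G O parcs G O parcs G \<subseteq> parcs G"
proof
  assume "two_qBMG G"
  then show "parcs G O parcs G O parcs G \<subseteq> parcs G"
    by (auto dest: two_qBMG.N2)
next
  assume N2: "parcs G O parcs G O parcs G \<subseteq> parcs G"
  have arcs: "parcs G \<subseteq> X \<times> Y \<union> Y \<times> X"
    and adj: "\<And>x y. \<lbrakk>x \<in> X; y \<in> Y\<rbrakk> \<Longrightarrow> (x, y) \<in> parcs G \<or> (y, x) \<in> parcs G"
    using A unfolding semicomplete_bipartite_def by blast+
  have colour: "x \<in> X \<and> y \<in> Y \<and> x \<notin> Y \<and> y \<notin> X \<or> x \<in> Y \<and> y \<in> X \<and> x \<notin> X \<and> y \<notin> Y"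
    if "(x, y) \<in> parcs G" for x y
    using that arcs assms(1) by blast
  show "two_qBMG G"
  proof
    show "bipartite_digraph G"
      unfolding bipartite_digraph_def using assms(1) V arcs by (intro exI[of _ X] exI[of _ Y]) simp
    show "fst e \<in> pverts G" "snd e \<in> pverts G" "fst e \<noteq> snd e" if "e \<in> parcs G" for e
      using that colour[of "fst e" "snd e"] V by auto
  next
    text \<open>(N1) is void: the endpoints of a path of length 3 lie in different colour classes,
      hence are adjacent.\<close>
    fix u v
    assume "u \<in> pverts G" "v \<in> pverts G" "u \<noteq> v" "(u, v) \<notin> parcs G" "(v, u) \<notin> parcs G"
    then have "u \<in> X \<longleftrightarrow> v \<in> X"
      using adj V by blast
    then show "\<not> (\<exists>w t. (u, t) \<in> parcs G \<and> (v, w) \<in> parcs G \<and> (t, w) \<in> parcs G)"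
    proof clarify
      fix w t assume "(u, t) \<in> parcs G" "(v, w) \<in> parcs G" "(t, w) \<in> parcs G"
      from this[THEN colour] \<open>u \<in> X \<longleftrightarrow> v \<in> X\<close> show False by metis
    qed
  next
    fix u v w t
    assume "(u, v) \<in> parcs G" "(v, w) \<in> parcs G" "(w, t) \<in> parcs G"
    then show "(u, t) \<in> parcs G"
      using N2 by blast
  next
    text \<open>(N3) is void: two incomparable out-neighbourhoods sharing a vertex would need three
      vertices of the same colour.\<close>
    fix u v x
    assume ux: "(u, x) \<in> parcs G" and vx: "(v, x) \<in> parcs G"
    show "parcs G `` {u} \<subseteq> parcs G `` {v} \<or> parcs G `` {v} \<subseteq> parcs G `` {u}"
    proof (rule ccontr)
      assume "\<not> ?thesis"
      then obtain y z where uy: "(u, y) \<in> parcs G" "(v, y) \<notin> parcs G"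
        and vz: "(v, z) \<in> parcs G" "(u, z) \<notin> parcs G"
        by blast
      then have "x \<noteq> y" "x \<noteq> z" "y \<noteq> z" using ux vx by auto
      then have "card {x, y, z} = 3" by simp
      moreover have "{x, y, z} \<subseteq> X \<or> {x, y, z} \<subseteq> Y"
        using colour[OF ux] colour[OF vx] colour[OF uy(1)] colour[OF vz(1)] by simp metis
      ultimately show False
        using card card_mono[OF fin(1), of "{x, y, z}"] card_mono[OF fin(2), of "{x, y, z}"] by linarith
    qed
  qed
qed

lemma C4_qBMGs_iff:
  "G \<in> C4_qBMGs V \<longleftrightarrow>
     (\<exists>a b c d. distinct [a, b, c, d] \<and> V = {a, b, c, d} \<and> pverts G = V \<and>
        semicomplete_bipartite {a, c} {b, d} (parcs G) \<and>
        parcs G O parcs G O parcs G \<subseteq> parcs G)"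
proof -
  have "two_qBMG G \<longleftrightarrow> parcs G O parcs G O parcs G \<subseteq> parcs G"
    if "distinct [a, b, c, d]" "pverts G = {a, b, c, d}"
      "semicomplete_bipartite {a, c} {b, d} (parcs G)" for a b c d
    using that by (intro two_qBMG_semicomplete_bipartite_iff) auto
  then show ?thesis
    unfolding C4_qBMGs_def is_cycle_graph_4_iff underlying_edges_4_cycle_iff mem_Collect_eq
    by metis
qed

section \<open>The ten arc sets and their completeness\<close>

text \<open>The vertices are parameters so that the same list can be read along any of the eight
  labelings of the cycle. A list fixes an order in which invariants are compared entry by
  entry.\<close>

definition C4_arc_sets :: "'a \<Rightarrow> 'a \<Rightarrow> 'a \<Rightarrow> 'a \<Rightarrow> ('a \<times> 'a) set list" where
  "C4_arc_sets a b c d =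
    [{(a,b), (a,d), (b,a), (b,c), (c,d), (d,c)},
     {(a,b), (a,d), (b,c), (c,b), (c,d), (d,c)},
     {(a,b), (a,d), (c,b), (c,d)},
     {(a,b), (a,d), (c,b), (d,c)},
     {(a,b), (b,a), (c,b), (c,d), (d,a)},
     {(a,b), (a,d), (c,b), (d,a), (d,c)},
     {(a,b), (a,d), (b,c), (d,c)},
     {(a,b), (a,d), (c,b), (c,d), (d,c)},
     {(a,b), (a,d), (b,a), (b,c), (c,b), (c,d)},
     {(a,b), (a,d), (c,b), (c,d), (b,a), (b,c), (d,a), (d,c)}]"

text \<open>Together with \<open>insert_Image\<close> this evaluates compositions of explicit arc
  sets by simplification, peeling off one arc at a time.\<close>

lemma insert_relcomp_eq: "insert (x, y) A O B = {x} \<times> (B `` {y}) \<union> A O B"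
  by auto

lemma insert_Image: "insert (x, y) A `` {z} = (if x = z then insert y (A `` {z}) else A `` {z})"
  by auto

lemma length_C4_arc_sets: "length (C4_arc_sets a b c d) = 10"
  by (simp add: C4_arc_sets_def)

lemma C4_arc_sets_semicomplete:
  assumes "A \<in> set (C4_arc_sets a b c d)"
  shows "semicomplete_bipartite {a, c} {b, d} A"
  using assms unfolding C4_arc_sets_def semicomplete_bipartite_def
  by (simp, elim disjE) simp_all

lemma C4_arc_sets_relcomp:
  assumes "distinct [a, b, c, d]" "A \<in> set (C4_arc_sets a b c d)"
  shows "A O A O A \<subseteq> A"
proof -
  have "a \<noteq> b" "a \<noteq> c" "a \<noteq> d" "b \<noteq> c" "b \<noteq> d" "c \<noteq> d"
    using assms(1) by auto
  note neq = this this[symmetric]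
  show ?thesis
    using assms(2) unfolding C4_arc_sets_def
    by (simp, elim disjE) (simp_all add: neq insert_relcomp_eq insert_Image)
qed

text \<open>The first two numbers leave four groups of ties, namely entries 1 and 10, 2 and 5, 6 and
  9, and 4, 7 and 8. The third number separates each group.\<close>

lemma C4_arc_sets_invariants:
  assumes "distinct [a, b, c, d]"
  shows "map arc_invariants (C4_arc_sets a b c d) =
    [(4,4,6), (4,3,6), (2,2,0), (3,3,2), (4,3,4), (3,4,4), (3,3,1), (3,3,4), (3,4,6), (4,4,8)]"
proof -
  have "a \<noteq> b" "a \<noteq> c" "a \<noteq> d" "b \<noteq> c" "b \<noteq> d" "c \<noteq> d"
    using assms(1) by auto
  note neq = this this[symmetric]
  show ?thesis
    unfolding C4_arc_sets_def arc_invariants_def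
    by (simp add: neq insert_relcomp_eq insert_Image card_insert_if)
qed

text \<open>The entries of an arc pattern say which of the arcs \<open>ab, ba, bc, cb, cd, dc, da, ad\<close> of the
  4-cycle \<open>abcd\<close> are present.\<close>

definition C4_arc_patterns :: "(bool \<times> bool \<times> bool \<times> bool \<times> bool \<times> bool \<times> bool \<times> bool) set" where
  "C4_arc_patterns =
    {(True, True, True, False, True, True, False, True),
     (True, False, True, True, True, True, False, True),
     (True, False, False, True, True, False, False, True),
     (True, False, False, True, False, True, False, True),
     (True, True, False, True, True, False, True, False),
     (True, False, False, True, False, True, True, True),
     (True, False, True, False, False, True, False, True),
     (True, False, False, True, True, True, False, True),
     (True, True, True, True, True, False, False, True),
     (True, True, True, True, True, True, True, True)}"

text \<open>The eight disjuncts are the symmetries of the 4-cycle; each further premise forbids a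
  directed path of length 3 without the arc from its start to its end.\<close>

lemma C4_arc_patterns_exhaustive:
  assumes "ab \<or> ba" "bc \<or> cb" "cd \<or> dc" "da \<or> ad"
    and "\<not> (ab \<and> bc \<and> cd \<and> \<not> ad)" "\<not> (bc \<and> cd \<and> da \<and> \<not> ba)"
    and "\<not> (cd \<and> da \<and> ab \<and> \<not> cb)" "\<not> (da \<and> ab \<and> bc \<and> \<not> dc)"
    and "\<not> (ad \<and> dc \<and> cb \<and> \<not> ab)" "\<not> (dc \<and> cb \<and> ba \<and> \<not> da)"
    and "\<not> (cb \<and> ba \<and> ad \<and> \<not> cd)" "\<not> (ba \<and> ad \<and> dc \<and> \<not> bc)"
  shows "(ab, ba, bc, cb, cd, dc, da, ad) \<in> C4_arc_patterns
    \<or> (bc, cb, cd, dc, da, ad, ab, ba) \<in> C4_arc_patterns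
    \<or> (cd, dc, da, ad, ab, ba, bc, cb) \<in> C4_arc_patterns
    \<or> (da, ad, ab, ba, bc, cb, cd, dc) \<in> C4_arc_patterns
    \<or> (ad, da, dc, cd, cb, bc, ba, ab) \<in> C4_arc_patterns
    \<or> (dc, cd, cb, bc, ba, ab, ad, da) \<in> C4_arc_patterns
    \<or> (cb, bc, ba, ab, ad, da, dc, cd) \<in> C4_arc_patterns
    \<or> (ba, ab, ad, da, dc, cd, cb, bc) \<in> C4_arc_patterns"
  using assms
  \<comment> \<open>All 256 truth assignments are examined. The cheap \<open>simp_thms\<close> pass,
    kept only if it closes the goal, discards those violating a premise; the rest are looked up in
    the table.\<close>
  by (cases ab; cases ba; cases bc; cases cb; cases cd; cases dc; cases da; cases ad;
      (simp only: simp_thms; fail)?) (simp_all add: C4_arc_patterns_def)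

text \<open>A set of arcs between the diagonals is determined by eight membership bits. This turns
  the classification into a propositional problem.\<close>

lemma C4_arc_sets_mem_iff:
  assumes "distinct [a, b, c, d]" and sub: "A \<subseteq> {a, c} \<times> {b, d} \<union> {b, d} \<times> {a, c}"
  shows "A \<in> set (C4_arc_sets a b c d) \<longleftrightarrow>
    ((a,b) \<in> A, (b,a) \<in> A, (b,c) \<in> A, (c,b) \<in> A, (c,d) \<in> A, (d,c) \<in> A, (d,a) \<in> A, (a,d) \<in> A) \<in> C4_arc_patterns"
proof -
  have "a \<noteq> b" "a \<noteq> c" "a \<noteq> d" "b \<noteq> c" "b \<noteq> d" "c \<noteq> d"
    using assms(1) by auto
  note neq = this this[symmetric]
  have eq_iff: "A = B \<longleftrightarrow> (\<forall>e \<in> {(a,b), (b,a), (b,c), (c,b), (c,d), (d,c), (d,a), (a,d)}. e \<in> A \<longleftrightarrow> e \<in> B)"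
    if "B \<subseteq> {(a,b), (b,a), (b,c), (c,b), (c,d), (d,c), (d,a), (a,d)}" for B
  proof -
    have "A \<subseteq> {(a,b), (b,a), (b,c), (c,b), (c,d), (d,c), (d,a), (a,d)}"
      using sub by auto
    with that show ?thesis by blast
  qed
  show ?thesis
    unfolding C4_arc_sets_def C4_arc_patterns_def by (simp add: eq_iff neq)
qed

lemma C4_arc_sets_exhaustive:
  assumes "distinct [a, b, c, d]" and A: "semicomplete_bipartite {a, c} {b, d} A"
    and tr: "A O A O A \<subseteq> A"
  shows "\<exists>(p, q, r, s) \<in> {(a,b,c,d), (b,c,d,a), (c,d,a,b), (d,a,b,c),
      (a,d,c,b), (d,c,b,a), (c,b,a,d), (b,a,d,c)}. A \<in> set (C4_arc_sets p q r s)"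
proof -
  have sub: "A \<subseteq> {a, c} \<times> {b, d} \<union> {b, d} \<times> {a, c}"
    using A unfolding semicomplete_bipartite_def by blast
  have "a \<noteq> b" "a \<noteq> c" "a \<noteq> d" "b \<noteq> c" "b \<noteq> d" "c \<noteq> d"
    using assms(1) by auto
  note neq = this this[symmetric]
  \<comment> \<open>The same inclusion, with the diagonals written as the other seven labelings
    produce them.\<close>
  have subs: "A \<subseteq> {c, a} \<times> {b, d} \<union> {b, d} \<times> {c, a}"
     "A \<subseteq> {a, c} \<times> {d, b} \<union> {d, b} \<times> {a, c}" "A \<subseteq> {c, a} \<times> {d, b} \<union> {d, b} \<times> {c, a}"
     "A \<subseteq> {b, d} \<times> {a, c} \<union> {a, c} \<times> {b, d}" "A \<subseteq> {b, d} \<times> {c, a} \<union> {c, a} \<times> {b, d}"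
     "A \<subseteq> {d, b} \<times> {a, c} \<union> {a, c} \<times> {d, b}" "A \<subseteq> {d, b} \<times> {c, a} \<union> {c, a} \<times> {d, b}"
    using sub by blast+
  note mem = C4_arc_sets_mem_iff[OF _ sub] subs[THEN C4_arc_sets_mem_iff[rotated]]
  have adj: "(a,b) \<in> A \<or> (b,a) \<in> A" "(b,c) \<in> A \<or> (c,b) \<in> A"
    "(c,d) \<in> A \<or> (d,c) \<in> A" "(d,a) \<in> A \<or> (a,d) \<in> A"
    using A unfolding semicomplete_bipartite_def by auto
  have path: "\<not> ((x, y) \<in> A \<and> (y, z) \<in> A \<and> (z, w) \<in> A \<and> (x, w) \<notin> A)" for x y z w
    using tr by blast
  have "A \<in> set (C4_arc_sets a b c d) \<or> A \<in> set (C4_arc_sets b c d a)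
      \<or> A \<in> set (C4_arc_sets c d a b) \<or> A \<in> set (C4_arc_sets d a b c)
      \<or> A \<in> set (C4_arc_sets a d c b) \<or> A \<in> set (C4_arc_sets d c b a)
      \<or> A \<in> set (C4_arc_sets c b a d) \<or> A \<in> set (C4_arc_sets b a d c)"
    \<comment> \<open>Each copy of \<open>path\<close> is instantiated by one of the eight directed
      paths of length 3 around the cycle, four in each direction.\<close>
    using C4_arc_patterns_exhaustive[OF adj path path path path path path path path]
    by (simp add: mem neq)
  then show ?thesis by simp
qed

text \<open>The symmetry of the cycle found by the case check is absorbed into the choice of
  \<open>p\<close>, \<open>q\<close>, \<open>r\<close>, \<open>s\<close>.\<close>

lemma C4_qBMGsE:
  assumes "G \<in> C4_qBMGs V"
  obtains p q r s where "distinct [p, q, r, s]" "V = {p, q, r, s}" "pverts G = V"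
    "parcs G \<in> set (C4_arc_sets p q r s)"
proof -
  from assms obtain a b c d where *: "distinct [a, b, c, d]" "V = {a, b, c, d}" "pverts G = V"
    "semicomplete_bipartite {a, c} {b, d} (parcs G)" "parcs G O parcs G O parcs G \<subseteq> parcs G"
    unfolding C4_qBMGs_iff by blast
  from C4_arc_sets_exhaustive[OF *(1,4,5)] obtain p q r s where
    "(p, q, r, s) \<in> {(a,b,c,d), (b,c,d,a), (c,d,a,b), (d,a,b,c),
      (a,d,c,b), (d,c,b,a), (c,b,a,d), (b,a,d,c)}" "parcs G \<in> set (C4_arc_sets p q r s)"
    by blast
  with *(1-3) show thesis
    by (intro that[of p q r s]) auto
qed

section \<open>Counting up to isomorphism\<close>

lemma obtain_permutes:
  assumes "distinct [p, q, r, s]" "{a, b, c, d} = {p, q, r, s}" "distinct [a, b, c, d]"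
  obtains \<phi> where "\<phi> permutes {a, b, c, d}" "\<phi> p = a" "\<phi> q = b" "\<phi> r = c" "\<phi> s = d"
proof -
  \<comment> \<open>Updating \<open>id\<close> makes the map fix everything outside the four
    vertices, as \<open>permutes\<close> demands.\<close>
  define \<phi> where "\<phi> = id(p := a, q := b, r := c, s := d)"
  have vals: "\<phi> p = a" "\<phi> q = b" "\<phi> r = c" "\<phi> s = d"
    using assms(1) by (auto simp: \<phi>_def)
  have "bij_betw \<phi> {p, q, r, s} {a, b, c, d}"
    using assms(1,3) vals by (auto simp: bij_betw_def)
  then have "\<phi> permutes {a, b, c, d}"
    using assms(2) by (intro bij_imp_permutes) (auto simp: \<phi>_def)
  with vals show thesis using that by blast
qed

theorem theorem3p11:
  fixes v1 v2 v3 v4 :: 'a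
  assumes "distinct [v1, v2, v3, v4]"
  shows
   "let V = {v1, v2, v3, v4};
        Gs = map (\<lambda>A. \<lparr>pverts = V, parcs = A\<rparr>)
          [{(v1,v2), (v1,v4), (v2,v1), (v2,v3), (v3,v4), (v4,v3)},
           {(v1,v2), (v1,v4), (v2,v3), (v3,v2), (v3,v4), (v4,v3)},
           {(v1,v2), (v1,v4), (v3,v2), (v3,v4)},
           {(v1,v2), (v1,v4), (v3,v2), (v4,v3)},
           {(v1,v2), (v2,v1), (v3,v2), (v3,v4), (v4,v1)},
           {(v1,v2), (v1,v4), (v3,v2), (v4,v1), (v4,v3)},
           {(v1,v2), (v1,v4), (v2,v3), (v4,v3)},
           {(v1,v2), (v1,v4), (v3,v2), (v3,v4), (v4,v3)},
           {(v1,v2), (v1,v4), (v2,v1), (v2,v3), (v3,v2), (v3,v4)},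
           {(v1,v2), (v1,v4), (v3,v2), (v3,v4), (v2,v1), (v2,v3), (v4,v1), (v4,v3)}]
    in card (C4_qBMGs V // {(G, H). G \<in> C4_qBMGs V \<and> H \<in> C4_qBMGs V \<and> isomorphic_digraphs G H}) = 10
     \<and> set Gs \<subseteq> C4_qBMGs V
     \<and> (\<forall>i<10. \<forall>j<10. i \<noteq> j \<longrightarrow> \<not> isomorphic_digraphs (Gs ! i) (Gs ! j))
     \<and> (\<forall>G\<in>C4_qBMGs V. \<exists>H\<in>set Gs. isomorphic_digraphs G H)"
proof -
  define V where "V = {v1, v2, v3, v4}"
  define Gs where "Gs = map (\<lambda>A. \<lparr>pverts = V, parcs = A\<rparr>) (C4_arc_sets v1 v2 v3 v4)"
  let ?iso = "{(G, H). G \<in> C4_qBMGs V \<and> H \<in> C4_qBMGs V \<and> isomorphic_digraphs G H}"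
  have len: "length Gs = 10"
    by (simp add: Gs_def length_C4_arc_sets)
  have Gs_C4: "set Gs \<subseteq> C4_qBMGs V"
  proof
    fix G assume "G \<in> set Gs"
    then have "pverts G = V" and "parcs G \<in> set (C4_arc_sets v1 v2 v3 v4)"
      unfolding Gs_def by auto
    with assms C4_arc_sets_semicomplete C4_arc_sets_relcomp[OF assms] show "G \<in> C4_qBMGs V"
      unfolding C4_qBMGs_iff by (intro exI[of _ v1] exI[of _ v2] exI[of _ v3] exI[of _ v4] conjI V_def)
  qed
  have non_iso: "\<not> isomorphic_digraphs (Gs ! i) (Gs ! j)" if "i < 10" "j < 10" "i \<noteq> j" for i j
  proof
    assume iso: "isomorphic_digraphs (Gs ! i) (Gs ! j)"
    have arcs: "parcs (Gs ! k) \<subseteq> pverts (Gs ! k) \<times> pverts (Gs ! k)" if "k < 10" for k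
    proof -
      have "Gs ! k \<in> C4_qBMGs V"
        using that len by (intro subsetD[OF Gs_C4] nth_mem) simp
      then have "two_qBMG (Gs ! k)"
        by (simp add: C4_qBMGs_def)
      then interpret two_qBMG "Gs ! k" .
      show ?thesis by (auto dest: in_arcsD1 in_arcsD2)
    qed
    let ?inv = "map (arc_invariants \<circ> parcs) Gs"
    have "?inv ! i = ?inv ! j"
      using isomorphic_digraphs_arc_invariants[OF iso arcs arcs] that len by simp
    moreover have "?inv = map arc_invariants (C4_arc_sets v1 v2 v3 v4)"
      unfolding Gs_def by simp
    \<comment> \<open>The ten triples are pairwise different, so equal invariants force equal
      indices.\<close>
    then have "distinct ?inv"
      unfolding C4_arc_sets_invariants[OF assms] by simp
    ultimately show False
      using that len by (simp add: nth_eq_iff_index_eq del: nth_map)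
  qed
  have cover: "\<exists>H\<in>set Gs. isomorphic_digraphs G H" if "G \<in> C4_qBMGs V" for G
  proof -
    from that obtain p q r s where pqrs: "distinct [p, q, r, s]" "V = {p, q, r, s}"
      and G: "pverts G = V" "parcs G \<in> set (C4_arc_sets p q r s)"
      by (rule C4_qBMGsE)
    from pqrs assms obtain \<phi> where \<phi>: "\<phi> permutes V"
      and map: "\<phi> p = v1" "\<phi> q = v2" "\<phi> r = v3" "\<phi> s = v4"
      unfolding V_def by (rule obtain_permutes)
    \<comment> \<open>Relabelling by \<open>\<phi>\<close> acts on the list entry by entry, so the
      image of \<open>parcs G\<close> occurs in the list for \<open>v1\<close>, \<open>v2\<close>,
      \<open>v3\<close>, \<open>v4\<close>.\<close>
    have sets: "C4_arc_sets v1 v2 v3 v4 = map ((`) (map_prod \<phi> \<phi>)) (C4_arc_sets p q r s)"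
      unfolding C4_arc_sets_def by (simp add: map)
    let ?H = "\<lparr>pverts = V, parcs = map_prod \<phi> \<phi> ` parcs G\<rparr>"
    have "?H \<in> set Gs"
      using G unfolding Gs_def sets by auto
    moreover have "isomorphic_digraphs G ?H"
      using \<phi> G(1) unfolding isomorphic_digraphs_def
      by (intro conjI exI[of _ \<phi>]) (auto dest: injD[OF permutes_inj])
    ultimately show ?thesis by blast
  qed
  \<comment> \<open>Equal entries would be isomorphic by reflexivity.\<close>
  have "distinct Gs"
    using non_iso len isomorphic_digraphs_refl unfolding distinct_conv_nth by metis
  have "card (C4_qBMGs V // ?iso) = card (set Gs)"
  proof (rule card_quotient_transversal[OF equiv_isomorphic_digraphs Gs_C4])
    show "G = H" if "G \<in> set Gs" "H \<in> set Gs" "(G, H) \<in> ?iso" for G H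
      using that non_iso len by (auto simp: in_set_conv_nth)
    show "\<exists>H\<in>set Gs. (G, H) \<in> ?iso" if "G \<in> C4_qBMGs V" for G
      using cover[OF that] that Gs_C4 by blast
  qed
  then have "card (C4_qBMGs V // ?iso) = 10"
    using distinct_card[OF \<open>distinct Gs\<close>] len by simp
  then have "card (C4_qBMGs V // ?iso) = 10 \<and> set Gs \<subseteq> C4_qBMGs V
      \<and> (\<forall>i<10. \<forall>j<10. i \<noteq> j \<longrightarrow> \<not> isomorphic_digraphs (Gs ! i) (Gs ! j))
      \<and> (\<forall>G\<in>C4_qBMGs V. \<exists>H\<in>set Gs. isomorphic_digraphs G H)"
    using Gs_C4 non_iso cover by blast
  then show ?thesis
    unfolding Let_def Gs_def C4_arc_sets_def V_def .
qed

end
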